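(* Let $(\Lambda,d)$ be a source-free $k$-graph, let $v\in\Lambda^0$, and let $r^{-1}(v)\cap\Lambda^1=\mathcal{E}_1\sqcup\mathcal{E}_2$ be a partition into two non-empty sets satisfying the pairing condition. Then the result $(\Lambda_I,d_I)$ of in-splitting $\Lambda$ at $v$ (with respect to this partition) is also a source-free $k$-graph.
   Context: Fix $k\ge1$; $0\in\mathbb{N}$; $e_1,\dots,e_k$ are the standard basis vectors of $\mathbb{N}^k$, and $\mathbb{N}^k$ is regarded as a category with one object, composition being addition. For $n=\sum n_ie_i$, $|n|=\sum n_i$. A $k$-graph is a countable category $\Lambda$ with a functor $d:\Lambda\to\mathbb{N}^k$ satisfying the factorization rule: for every morphism $\lambda$ and $n,m\in\mathbb{N}^k$ with $d(\lambda)=n+m$ there exist unique $\mu,\nu\in\Lambda$ with $d(\mu)=m$, $d(\nu)=n$, $\lambda=\mu\nu$. $\Lambda^n=d^{-1}(n)$; $\Lambda^0$ is the set of vertices (identified with objects); $\Lambda^1=\{\lambda:|d(\lambda)|=1\}$ is the set of edges. $r(\lambda),s(\lambda)\in\Lambda^0$ are the unique vertices with $r(\lambda)\lambda s(\lambda)=\lambda$. A vertex $v$ is a source if $r^{-1}(v)\cap\Lambda^{e_i}=\emptyset$ for some $i$; $\Lambda$ is source-free if it has no sources. The 1-skeleton of $\Lambda$ is the directed graph $G=(\Lambda^0,\Lambda^1,r,s)$ with edges colored by $d$. For any $k$-colored directed graph, the path category (denoted by $*$, e.g. $G^*$) consists of all finite paths $f_n\cdots f_1$ with $s(f_i)=r(f_{i-1})$,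 including vertices as paths of length $0$, with range, source and (additively extended) degree. On $G^*$, $\lambda\sim\mu$ means that $\lambda$ and $\mu$ compose to the same morphism of $\Lambda$; thus $\Lambda=G^*/\sim$. Pairing condition: if $a,f\in r^{-1}(v)\cap\Lambda^1$ and there exist edges $g,b\in\Lambda^1$ such that $ag\sim fb$, then $f$ and $a$ are contained in the same set $\mathcal{E}_j$. In-splitting: define the $k$-colored graph $G_I=(\Lambda_I^0,\Lambda_I^1,r_I,s_I)$ by $\Lambda_I^0=(\Lambda^0\setminus\{v\})\cup\{v^1,v^2\}$ and $\Lambda_I^1=(\Lambda^1\setminus s^{-1}(v))\cup\{f^1,f^2: f\in\Lambda^1,\ s(f)=v\}$, with $d_I(g)=d(g)$ for $g\in\Lambda^1\setminus s^{-1}(v)$ and $d_I(f^i)=d(f)$. Sources: $s_I(f)=s(f)$ if $s(f)\ne v$; $s_I(f^i)=v^i$ if $s(f)=v$. Ranges: an edge of $G_I$ of the form $f$ or $f^j$ has range $r(f)$ if $r(f)\neq v$, and has range $v^i$ if $r(f)=v$ and $f\in\mathcal{E}_i$. Define $par:G_I^*\to G^*$ by $par(w)=w$ for $w\in\Lambda^0\setminus\{v\}$, $par(v^i)=v$; $par(f^i)=f$ for the edges $f^1,f^2$, $par(f)=f$ for the other edges; and $par$ of a path is the concatenation of the $par$ of its edges. Define $\lambda\sim_I\mu$ on $G_I^*$ if and only if $par(\lambda)\sim par(\mu)$, $r_I(\lambda)=r_I(\mu)$ and $s_I(\lambda)=s_I(\mu)$. Then $\Lambda_I:=G_I^*/\sim_I$,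 with composition induced by concatenation and degree map induced by $d_I$, is the result of in-splitting $\Lambda$ at $v$. *)

theory Defs
  imports "HOL-Analysis.Finite_Cartesian_Product" "HOL-Library.Countable_Set"
begin

text \<open>
  Categories are given by their morphisms only: objects are identified with their identity
  morphisms, so \<open>rng\<close> and \<open>src\<close> return morphisms. The composite \<open>cmp C f g\<close> stands for \<open>f g\<close>
  (first \<open>g\<close>, then \<open>f\<close>) and is meaningful only if \<open>src C f = rng C g\<close>. The monoid
  of degrees is \<open>nat ^ 'k\<close> for a finite (nonempty) index type \<open>'k\<close>, with \<open>axis i 1\<close> as
  the basis vectors.
\<close>

record ('m, 'k) kcat =
  Mor :: "'m set"
  rng :: "'m \<Rightarrow> 'm"
  src :: "'m \<Rightarrow> 'm"
  cmp :: "'m \<Rightarrow> 'm \<Rightarrow> 'm"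
  deg :: "'m \<Rightarrow> nat ^ 'k"

definition total :: "nat ^ 'k \<Rightarrow> nat" where
  "total n = (\<Sum>i\<in>UNIV. n $ i)"

locale small_category =
  fixes C :: "('m, 'k::finite) kcat"
  assumes rng_Mor: "f \<in> Mor C \<Longrightarrow> rng C f \<in> Mor C"
    and src_Mor: "f \<in> Mor C \<Longrightarrow> src C f \<in> Mor C"
    and rng_rng: "f \<in> Mor C \<Longrightarrow> rng C (rng C f) = rng C f"
    and src_rng: "f \<in> Mor C \<Longrightarrow> src C (rng C f) = rng C f"
    and rng_src: "f \<in> Mor C \<Longrightarrow> rng C (src C f) = src C f"
    and src_src: "f \<in> Mor C \<Longrightarrow> src C (src C f) = src C f"
    and cmp_Mor: "\<lbrakk>f \<in> Mor C; g \<in> Mor C; src C f = rng C g\<rbrakk> \<Longrightarrow> cmp C f g \<in> Mor C"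
    and rng_cmp: "\<lbrakk>f \<in> Mor C; g \<in> Mor C; src C f = rng C g\<rbrakk> \<Longrightarrow> rng C (cmp C f g) = rng C f"
    and src_cmp: "\<lbrakk>f \<in> Mor C; g \<in> Mor C; src C f = rng C g\<rbrakk> \<Longrightarrow> src C (cmp C f g) = src C g"
    and cmp_rng: "f \<in> Mor C \<Longrightarrow> cmp C (rng C f) f = f"
    and cmp_src: "f \<in> Mor C \<Longrightarrow> cmp C f (src C f) = f"
    and cmp_assoc: "\<lbrakk>f \<in> Mor C; g \<in> Mor C; h \<in> Mor C; src C f = rng C g; src C g = rng C h\<rbrakk>
      \<Longrightarrow> cmp C (cmp C f g) h = cmp C f (cmp C g h)"

locale kgraph = small_category C for C :: "('m, 'k::finite) kcat" +
  assumes countable_Mor: "countable (Mor C)"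
    and deg_id: "f \<in> Mor C \<Longrightarrow> deg C (rng C f) = 0 \<and> deg C (src C f) = 0"
    and deg_cmp: "\<lbrakk>f \<in> Mor C; g \<in> Mor C; src C f = rng C g\<rbrakk>
      \<Longrightarrow> deg C (cmp C f g) = deg C f + deg C g"
    and factorization: "\<lbrakk>l \<in> Mor C; deg C l = n + m\<rbrakk>
      \<Longrightarrow> \<exists>!(\<mu>, \<nu>). \<mu> \<in> Mor C \<and> \<nu> \<in> Mor C \<and> deg C \<mu> = m \<and> deg C \<nu> = n
            \<and> src C \<mu> = rng C \<nu> \<and> l = cmp C \<mu> \<nu>"

definition mor_of_deg :: "('m, 'k::finite) kcat \<Rightarrow> nat ^ 'k \<Rightarrow> 'm set" where
  "mor_of_deg C n = {f \<in> Mor C. deg C f = n}"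

definition vertices :: "('m, 'k::finite) kcat \<Rightarrow> 'm set" where
  "vertices C = mor_of_deg C 0"

definition edges :: "('m, 'k::finite) kcat \<Rightarrow> 'm set" where
  "edges C = {f \<in> Mor C. total (deg C f) = 1}"

definition is_source :: "('m, 'k::finite) kcat \<Rightarrow> 'm \<Rightarrow> bool" where
  "is_source C v \<longleftrightarrow> v \<in> vertices C \<and> (\<exists>i. {f \<in> mor_of_deg C (axis i 1). rng C f = v} = {})"

definition source_free :: "('m, 'k::finite) kcat \<Rightarrow> bool" where
  "source_free C \<longleftrightarrow> (\<forall>v. \<not> is_source C v)"


record ('v, 'e, 'k) cgraph =
  Verts :: "'v set"
  Edges :: "'e set"
  erng :: "'e \<Rightarrow> 'v"
  esrc :: "'e \<Rightarrow> 'v"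
  color :: "'e \<Rightarrow> nat ^ 'k"

definition skeleton :: "('m, 'k::finite) kcat \<Rightarrow> ('m, 'm, 'k) cgraph" where
  "skeleton C = \<lparr>Verts = vertices C, Edges = edges C,
     erng = rng C, esrc = src C, color = deg C\<rparr>"

text \<open>
  \<open>Trail [f\<^sub>n, \<dots>, f\<^sub>1]\<close> is the path \<open>f\<^sub>n \<cdots> f\<^sub>1\<close>, whose range is that of \<open>f\<^sub>n\<close>; \<open>Trail []\<close> is
  not a path.
\<close>

datatype ('v, 'e) walk = Point 'v | Trail "'e list"

fun is_path :: "('v, 'e, 'k::finite) cgraph \<Rightarrow> ('v, 'e) walk \<Rightarrow> bool" where
  "is_path G (Point w) \<longleftrightarrow> w \<in> Verts G"
| "is_path G (Trail es) \<longleftrightarrow> es \<noteq> [] \<and> set es \<subseteq> Edges G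
     \<and> successively (\<lambda>f g. esrc G f = erng G g) es"

definition paths :: "('v, 'e, 'k::finite) cgraph \<Rightarrow> ('v, 'e) walk set" where
  "paths G = {p. is_path G p}"

fun path_rng :: "('v, 'e, 'k::finite) cgraph \<Rightarrow> ('v, 'e) walk \<Rightarrow> 'v" where
  "path_rng G (Point w) = w"
| "path_rng G (Trail es) = erng G (hd es)"

fun path_src :: "('v, 'e, 'k::finite) cgraph \<Rightarrow> ('v, 'e) walk \<Rightarrow> 'v" where
  "path_src G (Point w) = w"
| "path_src G (Trail es) = esrc G (last es)"

fun path_deg :: "('v, 'e, 'k::finite) cgraph \<Rightarrow> ('v, 'e) walk \<Rightarrow> nat ^ 'k" where
  "path_deg G (Point w) = 0"
| "path_deg G (Trail es) = sum_list (map (color G) es)"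

fun concat_path :: "('v, 'e) walk \<Rightarrow> ('v, 'e) walk \<Rightarrow> ('v, 'e) walk" where
  "concat_path (Point w) q = q"
| "concat_path (Trail es) (Point w) = Trail es"
| "concat_path (Trail es) (Trail fs) = Trail (es @ fs)"

fun compose_path :: "('m, 'k::finite) kcat \<Rightarrow> ('m, 'm) walk \<Rightarrow> 'm" where
  "compose_path C (Point w) = w"
| "compose_path C (Trail es) = foldr (cmp C) (butlast es) (last es)"

definition path_equiv :: "('m, 'k::finite) kcat \<Rightarrow> ('m, 'm) walk rel" where
  "path_equiv C = {(p, q). p \<in> paths (skeleton C) \<and> q \<in> paths (skeleton C)
     \<and> compose_path C p = compose_path C q}"


text \<open>A family \<open>E\<close> indexed by \<open>nat\<close> is used only at the indices 1 and 2.\<close>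

definition is_edge_partition :: "('m, 'k::finite) kcat \<Rightarrow> 'm \<Rightarrow> (nat \<Rightarrow> 'm set) \<Rightarrow> bool" where
  "is_edge_partition C v E \<longleftrightarrow> {f \<in> edges C. rng C f = v} = E 1 \<union> E 2
     \<and> E 1 \<inter> E 2 = {} \<and> E 1 \<noteq> {} \<and> E 2 \<noteq> {}"

definition pairing_condition :: "('m, 'k::finite) kcat \<Rightarrow> 'm \<Rightarrow> (nat \<Rightarrow> 'm set) \<Rightarrow> bool" where
  "pairing_condition C v E \<longleftrightarrow>
     (\<forall>a f. a \<in> edges C \<and> rng C a = v \<and> f \<in> edges C \<and> rng C f = v
        \<and> (\<exists>g\<in>edges C. \<exists>b\<in>edges C. (Trail [a, g], Trail [f, b]) \<in> path_equiv C)
        \<longrightarrow> (\<exists>j\<in>{1, 2}. f \<in> E j \<and> a \<in> E j))"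

text \<open>
  In the split graph, \<open>Orig x\<close> is a vertex or edge kept from the given graph and \<open>Copy i x\<close>
  is \<open>x\<^sup>i\<close>.
\<close>

datatype 'a split = Orig 'a | Copy nat 'a

fun par :: "'a split \<Rightarrow> 'a" where
  "par (Orig x) = x"
| "par (Copy i x) = x"

definition par_path :: "('v split, 'e split) walk \<Rightarrow> ('v, 'e) walk" where
  "par_path = map_walk par par"

definition split_vertices :: "('v, 'e, 'k::finite) cgraph \<Rightarrow> 'v \<Rightarrow> 'v split set" where
  "split_vertices G v = Orig ` (Verts G - {v}) \<union> {Copy 1 v, Copy 2 v}"

definition split_edges :: "('v, 'e, 'k::finite) cgraph \<Rightarrow> 'v \<Rightarrow> 'e split set" where
  "split_edges G v = Orig ` {f \<in> Edges G. esrc G f \<noteq> v}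
     \<union> {Copy i f | i f. i \<in> {1, 2} \<and> f \<in> Edges G \<and> esrc G f = v}"

fun split_src :: "('v, 'e, 'k::finite) cgraph \<Rightarrow> 'e split \<Rightarrow> 'v split" where
  "split_src G (Orig f) = Orig (esrc G f)"
| "split_src G (Copy i f) = Copy i (esrc G f)"

definition split_rng ::
    "('v, 'e, 'k::finite) cgraph \<Rightarrow> 'v \<Rightarrow> (nat \<Rightarrow> 'e set) \<Rightarrow> 'e split \<Rightarrow> 'v split" where
  "split_rng G v E e =
     (if erng G (par e) \<noteq> v then Orig (erng G (par e))
      else Copy (THE i. i \<in> {1, 2} \<and> par e \<in> E i) v)"

definition split_graph ::
    "('v, 'e, 'k::finite) cgraph \<Rightarrow> 'v \<Rightarrow> (nat \<Rightarrow> 'e set) \<Rightarrow> ('v split, 'e split, 'k) cgraph" where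
  "split_graph G v E = \<lparr>Verts = split_vertices G v, Edges = split_edges G v,
     erng = split_rng G v E, esrc = split_src G, color = (\<lambda>e. color G (par e))\<rparr>"

definition split_equiv ::
    "('m, 'k::finite) kcat \<Rightarrow> 'm \<Rightarrow> (nat \<Rightarrow> 'm set) \<Rightarrow> ('m split, 'm split) walk rel" where
  "split_equiv C v E = (let GI = split_graph (skeleton C) v E in
     {(p, q). p \<in> paths GI \<and> q \<in> paths GI
        \<and> (par_path p, par_path q) \<in> path_equiv C
        \<and> path_rng GI p = path_rng GI q \<and> path_src GI p = path_src GI q})"

text \<open>
  Operations on equivalence classes are induced from representatives: a union over all
  representatives is again a single class exactly when the induced operation is well defined, and
  likewise \<open>the_elem\<close> is determined exactly when the degree is constant on the class.
\<close>

definition in_splitting ::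
    "('m, 'k::finite) kcat \<Rightarrow> 'm \<Rightarrow> (nat \<Rightarrow> 'm set) \<Rightarrow> (('m split, 'm split) walk set, 'k) kcat" where
  "in_splitting C v E = (let GI = split_graph (skeleton C) v E; R = split_equiv C v E in
     \<lparr>Mor = paths GI // R,
      rng = (\<lambda>X. \<Union>p\<in>X. R `` {Point (path_rng GI p)}),
      src = (\<lambda>X. \<Union>p\<in>X. R `` {Point (path_src GI p)}),
      cmp = (\<lambda>X Y. \<Union>p\<in>X. \<Union>q\<in>Y. R `` {concat_path p q}),
      deg = (\<lambda>X. the_elem (path_deg GI ` X))\<rparr>)"

end

theory Submission imports Defs begin

text \<open>
  A path in the split graph is determined by its image under \<open>par\<close> together with its source: at
  each step the source picks the copy of the edge, and the edge determines the range. Hence a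
  morphism of the in-splitting amounts to a pair \<open>(\<lambda>, x)\<close> consisting of a morphism \<open>\<lambda>\<close> of the
  given \<open>k\<close>-graph and a vertex \<open>x\<close> of the split graph above the source of \<open>\<lambda>\<close>, provided that the
  range of a path depends on nothing else. This is where the pairing condition enters. If two
  edges \<open>a\<close> and \<open>f\<close> with range \<open>v\<close> are both initial (that is, leftmost) factors of \<open>\<lambda>\<close>, then
  either they have the same degree and are equal, or the initial factor of \<open>\<lambda>\<close> of degree \<open>d(a) + d(f)\<close> has the form
  \<open>ag = fb\<close>, so \<open>a\<close> and \<open>f\<close> lie in the same set of the partition
  (\<open>same_block_if_initial_edges\<close>).

  The pairs form a category \<open>split_model\<close>, in which \<open>(\<lambda>, x)\<close> and \<open>(\<mu>, y)\<close> are composable if \<open>x\<close> is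
  the lifted range of \<open>(\<mu>, y)\<close>, and the composite is \<open>(\<lambda>\<mu>, y)\<close>. Its factorizations are those of
  the given \<open>k\<close>-graph: if \<open>\<lambda> = \<mu>\<nu>\<close>, then \<open>(\<lambda>, x)\<close> factors only as \<open>(\<mu>, y)\<close> after \<open>(\<nu>, x)\<close>, where
  \<open>y\<close> is the lifted range of \<open>(\<nu>, x)\<close>. It has no sources if the given \<open>k\<close>-graph
  has none; only the two copies of \<open>v\<close> need an argument. For an edge
  \<open>a\<close> in the \<open>j\<close>-th set and any colour \<open>i\<close> there is a composite \<open>ab\<close> with \<open>b\<close> of colour \<open>i\<close>, and
  refactoring it gives an initial edge of colour \<open>i\<close>, which lies in the same set as \<open>a\<close>
  (\<open>block_contains_all_colours\<close>). Sending a pair to the class of the paths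
  that evaluate to it is an isomorphism onto the in-splitting, and it transports both properties.
\<close>

section \<open>Factorizations in a k-graph\<close>

lemma total_plus: "total (m + n) = total m + total n"
  by (simp add: total_def sum.distrib)

text \<open>The form with \<open>Suc 0\<close> is the one that the simplifier reaches.\<close>

lemma total_axis [simp]: "total (axis i (Suc 0)) = 1"
  by (simp add: total_def axis_def)

lemma total_eq_0_iff [simp]: "total n = 0 \<longleftrightarrow> n = 0"
  by (simp add: total_def vec_eq_iff)

lemma degree_split:
  fixes n :: "nat ^ 'k::finite"
  assumes "n $ i \<noteq> 0"
  obtains m where "n = axis i 1 + m"
proof
  show "n = axis i 1 + (\<chi> j. n $ j - axis i 1 $ j)"
    using assms by (auto simp: vec_eq_iff axis_def)
qed

lemma total_eq_1_axis:
  fixes n :: "nat ^ 'k::finite"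
  assumes "total n = 1"
  obtains i where "n = axis i 1"
proof -
  have "n \<noteq> 0" using assms total_eq_0_iff[of n] by auto
  then obtain i where "n $ i \<noteq> 0" by (auto simp: vec_eq_iff)
  then obtain m where m: "n = axis i 1 + m" by (rule degree_split)
  then have "total m = 0" using assms by (simp add: total_plus)
  then show thesis using m that by simp
qed

context kgraph
begin

lemma factorization_exists:
  assumes "l \<in> Mor C" "deg C l = m + n"
  obtains \<mu> \<nu> where "\<mu> \<in> Mor C" "\<nu> \<in> Mor C" "deg C \<mu> = m" "deg C \<nu> = n"
    "src C \<mu> = rng C \<nu>" "l = cmp C \<mu> \<nu>"
  using factorization[of l n m] assms by (auto simp: add.commute)

lemma factorization_unique:
  assumes "\<mu> \<in> Mor C" "\<nu> \<in> Mor C" "src C \<mu> = rng C \<nu>"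
    and "\<mu>' \<in> Mor C" "\<nu>' \<in> Mor C" "src C \<mu>' = rng C \<nu>'"
    and "cmp C \<mu> \<nu> = cmp C \<mu>' \<nu>'" "deg C \<mu> = deg C \<mu>'"
  shows "\<mu> = \<mu>' \<and> \<nu> = \<nu>'"
proof -
  have d: "deg C (cmp C \<mu> \<nu>) = deg C \<nu> + deg C \<mu>"
    using deg_cmp[OF assms(1-3)] by (simp add: add.commute)
  have "deg C (cmp C \<mu>' \<nu>') = deg C \<nu>' + deg C \<mu>'"
    using deg_cmp[OF assms(4-6)] by (simp add: add.commute)
  then have "deg C \<nu> = deg C \<nu>'" using d assms(7,8) by (metis add_right_cancel)
  let ?P = "\<lambda>(\<alpha>, \<beta>). \<alpha> \<in> Mor C \<and> \<beta> \<in> Mor C \<and> deg C \<alpha> = deg C \<mu> \<and> deg C \<beta> = deg C \<nu>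
    \<and> src C \<alpha> = rng C \<beta> \<and> cmp C \<mu> \<nu> = cmp C \<alpha> \<beta>"
  have ex: "\<exists>!z. ?P z" using factorization[OF cmp_Mor[OF assms(1-3)] d] .
  have "?P (\<mu>, \<nu>)" using assms(1-3) by simp
  moreover have "?P (\<mu>', \<nu>')"
    using assms(4-8) \<open>deg C \<nu> = deg C \<nu>'\<close> by simp
  ultimately have "(\<mu>, \<nu>) = (\<mu>', \<nu>')"
    using the1_equality[OF ex, of "(\<mu>, \<nu>)"] the1_equality[OF ex, of "(\<mu>', \<nu>')"] by simp
  then show ?thesis by simp
qed

lemma deg_0_identity:
  assumes "f \<in> Mor C" "deg C f = 0"
  shows "rng C f = f" "src C f = f"
proof -
  have "rng C f = f \<and> f = src C f"
    using assms by (intro factorization_unique)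
      (auto simp: rng_Mor src_Mor src_rng rng_src cmp_rng cmp_src deg_id)
  then show "rng C f = f" "src C f = f" by auto
qed

lemma rng_vertex: "f \<in> Mor C \<Longrightarrow> rng C f \<in> vertices C"
  and src_vertex: "f \<in> Mor C \<Longrightarrow> src C f \<in> vertices C"
  by (auto simp: vertices_def mor_of_deg_def rng_Mor src_Mor deg_id)

lemma vertexD:
  assumes "w \<in> vertices C"
  shows "w \<in> Mor C" "deg C w = 0" "rng C w = w" "src C w = w"
  using assms deg_0_identity by (auto simp: vertices_def mor_of_deg_def)

text \<open>
  The edge \<open>a\<close> is a leftmost factor of \<open>l\<close>, so it has the same range as \<open>l\<close>. There is one such edge
  for each colour that occurs in the degree of \<open>l\<close>.
\<close>

definition initial_edge :: "'m \<Rightarrow> 'm \<Rightarrow> bool" where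
  "initial_edge a l \<longleftrightarrow> a \<in> edges C \<and> (\<exists>\<mu>\<in>Mor C. src C a = rng C \<mu> \<and> l = cmp C a \<mu>)"

lemma edge_Mor: "a \<in> edges C \<Longrightarrow> a \<in> Mor C"
  by (simp add: edges_def)

lemma initial_edge_exists:
  assumes "l \<in> Mor C" "deg C l \<noteq> 0"
  shows "\<exists>a. initial_edge a l"
proof -
  from assms obtain i where "deg C l $ i \<noteq> 0" by (auto simp: vec_eq_iff)
  then obtain m where "deg C l = axis i 1 + m" by (rule degree_split)
  then obtain a \<mu> where a: "a \<in> Mor C" "\<mu> \<in> Mor C" "deg C a = axis i 1"
    "src C a = rng C \<mu>" "l = cmp C a \<mu>"
    using factorization_exists[OF assms(1)] by metis
  then have "initial_edge a l" by (auto simp: initial_edge_def edges_def)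
  then show ?thesis ..
qed

lemma initial_edge_rng: "initial_edge a l \<Longrightarrow> rng C a = rng C l"
  by (auto simp: initial_edge_def rng_cmp edge_Mor)

lemma initial_edge_cmp:
  assumes "initial_edge a l" "l \<in> Mor C" "\<mu> \<in> Mor C" "src C l = rng C \<mu>"
  shows "initial_edge a (cmp C l \<mu>)"
proof -
  obtain \<kappa> where k: "a \<in> edges C" "\<kappa> \<in> Mor C" "src C a = rng C \<kappa>" "l = cmp C a \<kappa>"
    using assms(1) by (auto simp: initial_edge_def)
  have s: "src C \<kappa> = rng C \<mu>" using k assms by (simp add: src_cmp edge_Mor)
  have "cmp C l \<mu> = cmp C a (cmp C \<kappa> \<mu>)"
    using k s assms by (simp add: cmp_assoc edge_Mor)
  moreover have "cmp C \<kappa> \<mu> \<in> Mor C" "src C a = rng C (cmp C \<kappa> \<mu>)"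
    using k s assms by (simp_all add: cmp_Mor rng_cmp)
  ultimately show ?thesis using k by (auto simp: initial_edge_def)
qed

lemma initial_edge_refl: "a \<in> edges C \<Longrightarrow> initial_edge a a"
  using edge_Mor[of a] cmp_src[of a] rng_src[of a] src_Mor[of a]
  by (auto simp: initial_edge_def intro!: bexI[of _ "src C a"])

lemma edge_deg_nonzero: "a \<in> edges C \<Longrightarrow> deg C a \<noteq> 0"
  by (auto simp: edges_def total_def)

text \<open>Two distinct initial edges of a morphism span a commuting square.\<close>

lemma initial_edges_square:
  assumes a: "initial_edge a l" and f: "initial_edge f l" and "a \<noteq> f"
  obtains g b where "g \<in> edges C" "b \<in> edges C" "src C a = rng C g" "src C f = rng C b"
    "cmp C a g = cmp C f b"
proof -
  obtain \<mu> where \<mu>: "a \<in> edges C" "\<mu> \<in> Mor C" "src C a = rng C \<mu>" "l = cmp C a \<mu>"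
    using a by (auto simp: initial_edge_def)
  obtain \<nu> where \<nu>: "f \<in> edges C" "\<nu> \<in> Mor C" "src C f = rng C \<nu>" "l = cmp C f \<nu>"
    using f by (auto simp: initial_edge_def)
  note M = edge_Mor[OF \<mu>(1)] edge_Mor[OF \<nu>(1)]
  have lM: "l \<in> Mor C" using \<mu> M by (simp add: cmp_Mor)
  have ne: "deg C a \<noteq> deg C f"
    using factorization_unique[of a \<mu> f \<nu>] \<mu> \<nu> M \<open>a \<noteq> f\<close> by auto
  obtain i where i: "deg C a = axis i 1"
    using \<mu>(1) total_eq_1_axis by (auto simp: edges_def)
  obtain j where j: "deg C f = axis j 1"
    using \<nu>(1) total_eq_1_axis by (auto simp: edges_def)
  have "i \<noteq> j" using ne i j by auto
  have d: "axis i 1 + deg C \<mu> = axis j 1 + deg C \<nu>"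
    using deg_cmp[OF M(1) \<mu>(2,3)] deg_cmp[OF M(2) \<nu>(2,3)] \<mu>(4) \<nu>(4) i j by simp
  then have "(axis i 1 + deg C \<mu>) $ j = (axis j 1 + deg C \<nu>) $ j" by simp
  then have "deg C \<mu> $ j \<noteq> 0" using \<open>i \<noteq> j\<close> by (simp add: axis_def)
  then obtain r where r: "deg C \<mu> = axis j 1 + r" by (rule degree_split)
  have "deg C l = (deg C a + deg C f) + r"
    using deg_cmp[OF M(1) \<mu>(2,3)] \<mu>(4) i j r by (simp add: add.assoc)
  then obtain \<kappa> \<rho> where k: "\<kappa> \<in> Mor C" "\<rho> \<in> Mor C" "deg C \<kappa> = deg C a + deg C f"
    "src C \<kappa> = rng C \<rho>" "l = cmp C \<kappa> \<rho>"
    using factorization_exists[OF lM] by metis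
  \<comment> \<open>Both edges are leftmost factors already of \<open>\<kappa>\<close>, by uniqueness of the factorization of \<open>l\<close>.\<close>
  have initial: "\<exists>h\<in>edges C. src C c = rng C h \<and> \<kappa> = cmp C c h"
    if c: "initial_edge c l" and e: "deg C \<kappa> = deg C c + e" and te: "total e = 1" for c e
  proof -
    from c obtain \<tau> where t: "c \<in> Mor C" "\<tau> \<in> Mor C" "src C c = rng C \<tau>" "l = cmp C c \<tau>"
      by (auto simp: initial_edge_def edge_Mor)
    obtain c' h where h: "c' \<in> Mor C" "h \<in> Mor C" "deg C c' = deg C c" "deg C h = e"
      "src C c' = rng C h" "\<kappa> = cmp C c' h"
      using factorization_exists[OF k(1) e] .
    have s: "src C h = rng C \<rho>" using h k by (simp add: src_cmp)
    have "cmp C c' (cmp C h \<rho>) = cmp C c \<tau>"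
      using h s k t by (simp add: cmp_assoc)
    then have "c' = c"
      using factorization_unique[of c' "cmp C h \<rho>" c \<tau>] h s k t by (simp add: cmp_Mor rng_cmp)
    then show ?thesis using h te by (auto simp: edges_def)
  qed
  have "total (deg C f) = 1" "total (deg C a) = 1" using i j by simp_all
  with initial[OF a k(3)] initial[OF f, of "deg C a"] k(3) that show thesis
    by (metis add.commute)
qed

end

section \<open>Composites of paths\<close>

lemma skeleton_simps [simp]:
  "Verts (skeleton C) = vertices C" "Edges (skeleton C) = edges C"
  "erng (skeleton C) = rng C" "esrc (skeleton C) = src C" "color (skeleton C) = deg C"
  by (simp_all add: skeleton_def)

lemma path_induct [consumes 1, case_names Point Edge Cons]:
  assumes p: "p \<in> paths G"
    and "\<And>w. w \<in> Verts G \<Longrightarrow> P (Point w)"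
    and edge: "\<And>e. e \<in> Edges G \<Longrightarrow> P (Trail [e])"
    and cons: "\<And>e f es. \<lbrakk>e \<in> Edges G; Trail (f # es) \<in> paths G; esrc G e = erng G f;
           P (Trail (f # es))\<rbrakk> \<Longrightarrow> P (Trail (e # f # es))"
  shows "P p"
proof (cases p)
  case (Point w)
  then show ?thesis using assms by (simp add: paths_def)
next
  case (Trail es)
  have "P (Trail es)" if "Trail es \<in> paths G"
    using that
  proof (induction es rule: induct_list012)
    case 1
    then show ?case by (simp add: paths_def)
  next
    case (2 e)
    then show ?case using edge by (simp add: paths_def)
  next
    case (3 e f es)
    then show ?case using cons by (auto simp: paths_def)
  qed
  then show ?thesis using p Trail by simp
qed

lemma concat_path_in_paths:
  assumes "p \<in> paths G" "q \<in> paths G" "path_src G p = path_rng G q"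
  shows "concat_path p q \<in> paths G"
    "path_rng G (concat_path p q) = path_rng G p"
    "path_src G (concat_path p q) = path_src G q"
  using assms
  by (cases p; cases q; auto simp: paths_def successively_append_iff)+

lemma path_ends_in_Verts:
  assumes "p \<in> paths G" "\<And>e. e \<in> Edges G \<Longrightarrow> erng G e \<in> Verts G"
    "\<And>e. e \<in> Edges G \<Longrightarrow> esrc G e \<in> Verts G"
  shows "path_rng G p \<in> Verts G" "path_src G p \<in> Verts G"
  using assms(1) by (induction rule: path_induct) (auto simp: assms(2,3))

context kgraph
begin

lemma compose_path_Mor:
  assumes "p \<in> paths (skeleton C)"
  shows "compose_path C p \<in> Mor C \<and> rng C (compose_path C p) = path_rng (skeleton C) p
    \<and> src C (compose_path C p) = path_src (skeleton C) p
    \<and> deg C (compose_path C p) = path_deg (skeleton C) p"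
  using assms
  by (induction rule: path_induct)
    (auto simp: vertexD edge_Mor cmp_Mor rng_cmp src_cmp deg_cmp)

lemma compose_path_concat:
  assumes "p \<in> paths (skeleton C)" "q \<in> paths (skeleton C)"
    "path_src (skeleton C) p = path_rng (skeleton C) q"
  shows "compose_path C (concat_path p q) = cmp C (compose_path C p) (compose_path C q)"
  using assms(1,3)
proof (induction rule: path_induct)
  case (Point w)
  then have "w = rng C (compose_path C q)" using compose_path_Mor[OF assms(2)] by simp
  then show ?case
    using compose_path_Mor[OF assms(2)] cmp_rng[of "compose_path C q"] by simp
next
  case (Edge e)
  then show ?case using compose_path_Mor[OF assms(2)] assms(2)
    by (cases q) (auto simp: paths_def cmp_src[OF edge_Mor])
next
  case (Cons e f es)
  let ?t = "Trail (f # es)"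
  have c: "compose_path C (concat_path (Trail (e # f # es)) q)
      = cmp C e (compose_path C (concat_path ?t q))"
    using assms(2) by (cases q) (auto simp: paths_def)
  show ?case
    using compose_path_Mor[OF assms(2)] compose_path_Mor[OF Cons(2)] Cons Cons(1) edge_Mor[of e]
    unfolding c by (simp add: cmp_assoc)
qed

end

section \<open>Isomorphisms of k-graphs\<close>

text \<open>
  Nothing is assumed about \<open>D\<close> beyond the compatibility of its operations with \<open>\<phi>\<close>, so that being
  a \<open>k\<close>-graph passes from \<open>C\<close> to \<open>D\<close>.
\<close>

locale kcat_iso =
  fixes C :: "('m, 'k::finite) kcat" and D :: "('n, 'k) kcat" and \<phi> :: "'m \<Rightarrow> 'n"
  assumes bij: "bij_betw \<phi> (Mor C) (Mor D)"
    and rng_iso: "f \<in> Mor C \<Longrightarrow> rng D (\<phi> f) = \<phi> (rng C f)"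
    and src_iso: "f \<in> Mor C \<Longrightarrow> src D (\<phi> f) = \<phi> (src C f)"
    and deg_iso: "f \<in> Mor C \<Longrightarrow> deg D (\<phi> f) = deg C f"
    and cmp_iso: "\<lbrakk>f \<in> Mor C; g \<in> Mor C; src C f = rng C g\<rbrakk>
      \<Longrightarrow> cmp D (\<phi> f) (\<phi> g) = \<phi> (cmp C f g)"
begin

lemma Mor_image: "Mor D = \<phi> ` Mor C"
  using bij by (simp add: bij_betw_def)

lemma iso_eq_iff: "\<lbrakk>f \<in> Mor C; g \<in> Mor C\<rbrakk> \<Longrightarrow> \<phi> f = \<phi> g \<longleftrightarrow> f = g"
  using bij by (auto simp: bij_betw_def inj_on_def)

lemma iso_Mor: "f \<in> Mor C \<Longrightarrow> \<phi> f \<in> Mor D"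
  by (simp add: Mor_image)

lemma kgraph_iso:
  assumes "kgraph C"
  shows "kgraph D"
proof -
  interpret kgraph C by fact
  note iso = rng_iso src_iso deg_iso cmp_iso iso_eq_iff iso_Mor
    rng_Mor src_Mor cmp_Mor rng_cmp src_cmp deg_cmp
    rng_rng src_rng rng_src src_src cmp_rng cmp_src cmp_assoc deg_id
  show ?thesis
  proof
    fix l and n m :: "nat ^ 'k"
    assume "l \<in> Mor D" "deg D l = n + m"
    then obtain l' where l: "l' \<in> Mor C" "l = \<phi> l'" "deg C l' = m + n"
      by (auto simp: Mor_image deg_iso add.commute)
    obtain \<mu> \<nu> where f: "\<mu> \<in> Mor C" "\<nu> \<in> Mor C" "deg C \<mu> = m" "deg C \<nu> = n"
      "src C \<mu> = rng C \<nu>" "l' = cmp C \<mu> \<nu>"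
      using factorization_exists[OF l(1,3)] .
    show "\<exists>!(\<mu>, \<nu>). \<mu> \<in> Mor D \<and> \<nu> \<in> Mor D \<and> deg D \<mu> = m \<and> deg D \<nu> = n
            \<and> src D \<mu> = rng D \<nu> \<and> l = cmp D \<mu> \<nu>"
    proof (rule ex1I[of _ "(\<phi> \<mu>, \<phi> \<nu>)"], goal_cases)
      case 1
      then show ?case using l f by (simp add: iso)
    next
      case (2 y)
      then obtain \<alpha> \<beta> where y: "y = (\<phi> \<alpha>, \<phi> \<beta>)" "\<alpha> \<in> Mor C" "\<beta> \<in> Mor C"
        by (auto simp: Mor_image)
      then have "deg C \<alpha> = m" "src C \<alpha> = rng C \<beta>"
        using 2 by (simp_all add: iso)
      moreover from this have "cmp C \<mu> \<nu> = cmp C \<alpha> \<beta>"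
        using 2 y l f by (simp add: iso)
      ultimately have "\<mu> = \<alpha> \<and> \<nu> = \<beta>"
        using y f by (intro factorization_unique) auto
      then show ?case using y by simp
    qed
  qed (use countable_Mor in \<open>auto simp: Mor_image iso\<close>)
qed

lemma source_free_iso:
  assumes "small_category C" "source_free C"
  shows "source_free D"
  unfolding source_free_def is_source_def
proof (intro allI notI, elim conjE exE)
  interpret small_category C by fact
  fix w i
  assume "w \<in> vertices D" and none: "{f \<in> mor_of_deg D (axis i 1). rng D f = w} = {}"
  then obtain x where x: "x \<in> vertices C" "w = \<phi> x"
    by (auto simp: vertices_def mor_of_deg_def Mor_image deg_iso)
  then obtain f where "f \<in> mor_of_deg C (axis i 1)" "rng C f = x"
    using assms(2) by (auto simp: source_free_def is_source_def)
  then have "\<phi> f \<in> {f \<in> mor_of_deg D (axis i 1). rng D f = w}"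
    using x by (auto simp: mor_of_deg_def iso_Mor deg_iso rng_iso)
  with none show False by blast
qed

end

section \<open>The category of lifted morphisms\<close>

text \<open>
  The data of an in-splitting at \<open>v\<close>: the edges with range \<open>v\<close> are partitioned into the two
  blocks \<open>E 1\<close> and \<open>E 2\<close>.
\<close>

locale splitting = kgraph \<Lambda> for \<Lambda> :: "('m, 'k::finite) kcat" +
  fixes v :: 'm and E :: "nat \<Rightarrow> 'm set"
  assumes v_vertex: "v \<in> vertices \<Lambda>"
    and partition: "is_edge_partition \<Lambda> v E"
    and pairing: "pairing_condition \<Lambda> v E"
begin

abbreviation GI :: "('m split, 'm split, 'k) cgraph" where
  "GI \<equiv> split_graph (skeleton \<Lambda>) v E"

lemma GI_simps [simp]:
  "Verts GI = split_vertices (skeleton \<Lambda>) v" "Edges GI = split_edges (skeleton \<Lambda>) v"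
  "erng GI = split_rng (skeleton \<Lambda>) v E" "esrc GI = split_src (skeleton \<Lambda>)"
  "color GI = (\<lambda>e. deg \<Lambda> (par e))"
  by (simp_all add: split_graph_def)

lemma par_Verts: "x \<in> Verts GI \<Longrightarrow> par x \<in> vertices \<Lambda>"
  using v_vertex by (auto simp: split_vertices_def)

lemma lift_vertex_exists: "w \<in> vertices \<Lambda> \<Longrightarrow> \<exists>x\<in>Verts GI. par x = w"
  by (cases "w = v") (auto simp: split_vertices_def)

lemma par_Edges: "e \<in> Edges GI \<Longrightarrow> par e \<in> edges \<Lambda>"
  by (auto simp: split_edges_def)

lemma par_split_src: "par (esrc GI e) = src \<Lambda> (par e)"
  by (cases e) auto

lemma split_src_Verts: "e \<in> Edges GI \<Longrightarrow> esrc GI e \<in> Verts GI"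
  using src_vertex by (auto simp: split_edges_def split_vertices_def edge_Mor)

text \<open>Edges lift uniquely once a lift of their source is given; only existence is needed.\<close>

lemma lift_edge:
  assumes "a \<in> edges \<Lambda>" "x \<in> Verts GI" "par x = src \<Lambda> a"
  obtains e where "e \<in> Edges GI" "par e = a" "esrc GI e = x"
proof (cases x)
  case (Orig w)
  with assms have "Orig a \<in> Edges GI" "esrc GI (Orig a) = x"
    by (auto simp: split_edges_def split_vertices_def)
  then show thesis using that by fastforce
next
  case (Copy i w)
  with assms have "Copy i a \<in> Edges GI" "esrc GI (Copy i a) = x"
    by (auto simp: split_edges_def split_vertices_def)
  then show thesis using that by fastforce
qed

lemma block_unique:
  assumes "a \<in> E i" "a \<in> E j" "i \<in> {1, 2}" "j \<in> {1, 2}"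
  shows "i = j"
  using assms partition by (auto simp: is_edge_partition_def)

lemma block_exists:
  assumes "a \<in> edges \<Lambda>" "rng \<Lambda> a = v"
  obtains i where "i \<in> {1, 2}" "a \<in> E i"
  using partition assms by (auto simp: is_edge_partition_def)

lemma block_edge: "\<lbrakk>i \<in> {1, 2}; a \<in> E i\<rbrakk> \<Longrightarrow> a \<in> edges \<Lambda> \<and> rng \<Lambda> a = v"
  using partition by (auto simp: is_edge_partition_def)

lemma split_rng_block:
  assumes "par e \<in> E i" "i \<in> {1, 2}"
  shows "erng GI e = Copy i v"
proof -
  have "(THE j. j \<in> {1, 2} \<and> par e \<in> E j) = i"
    using assms block_unique by (intro the_equality) blast+
  then show ?thesis using block_edge assms by (simp add: split_rng_def)
qed

lemma split_rng_other: "rng \<Lambda> (par e) \<noteq> v \<Longrightarrow> erng GI e = Orig (rng \<Lambda> (par e))"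
  by (simp add: split_rng_def)

lemma split_rng_Verts:
  assumes "par e \<in> edges \<Lambda>"
  shows "erng GI e \<in> Verts GI" "par (erng GI e) = rng \<Lambda> (par e)"
proof -
  have "erng GI e \<in> Verts GI \<and> par (erng GI e) = rng \<Lambda> (par e)"
  proof (cases "rng \<Lambda> (par e) = v")
    case True
    with assms obtain i where i: "i \<in> {1, 2}" "par e \<in> E i" using block_exists by metis
    then have "erng GI e = Copy i v" by (intro split_rng_block)
    then show ?thesis using i True by (auto simp: split_vertices_def)
  next
    case False
    then have "erng GI e = Orig (rng \<Lambda> (par e))" by (rule split_rng_other)
    then show ?thesis using False assms rng_vertex edge_Mor by (simp add: split_vertices_def)
  qed
  then show "erng GI e \<in> Verts GI" "par (erng GI e) = rng \<Lambda> (par e)" by auto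
qed

text \<open>The pairing condition, in terms of composites in the category.\<close>

lemma square_same_block:
  assumes "a \<in> E i" "i \<in> {1, 2}" "f \<in> edges \<Lambda>" "g \<in> edges \<Lambda>" "b \<in> edges \<Lambda>"
    "src \<Lambda> a = rng \<Lambda> g" "src \<Lambda> f = rng \<Lambda> b" "cmp \<Lambda> a g = cmp \<Lambda> f b"
  shows "f \<in> E i"
proof -
  have a: "a \<in> edges \<Lambda>" "rng \<Lambda> a = v" using assms block_edge by auto
  have "rng \<Lambda> f = rng \<Lambda> a"
    using assms a by (metis edge_Mor rng_cmp)
  moreover have "(Trail [a, g], Trail [f, b]) \<in> path_equiv \<Lambda>"
    using assms a by (auto simp: path_equiv_def paths_def)
  ultimately obtain j where "j \<in> {1, 2}" "f \<in> E j" "a \<in> E j"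
    using pairing assms a unfolding pairing_condition_def by metis
  moreover from this have "i = j" using block_unique assms(1,2) by metis
  ultimately show ?thesis by simp
qed

lemma same_block_if_initial_edges:
  assumes "initial_edge a l" "initial_edge f l" "a \<in> E i" "i \<in> {1, 2}"
  shows "f \<in> E i"
proof (cases "a = f")
  case False
  obtain g b where "g \<in> edges \<Lambda>" "b \<in> edges \<Lambda>"
    "src \<Lambda> a = rng \<Lambda> g" "src \<Lambda> f = rng \<Lambda> b" "cmp \<Lambda> a g = cmp \<Lambda> f b"
    using initial_edges_square[OF assms(1,2) False] .
  moreover have "f \<in> edges \<Lambda>" using assms(2) by (simp add: initial_edge_def)
  ultimately show ?thesis using square_same_block assms(3,4) by metis
qed (use assms in simp)

lemma split_rng_initial:
  assumes "initial_edge (par e) l" "initial_edge (par e') l"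
  shows "erng GI e = erng GI e'"
proof (cases "rng \<Lambda> l = v")
  case True
  then have "par e \<in> edges \<Lambda>" "rng \<Lambda> (par e) = v"
    using assms(1) initial_edge_rng[OF assms(1)] by (simp_all add: initial_edge_def)
  then obtain i where i: "i \<in> {1, 2}" "par e \<in> E i" using block_exists by metis
  have "par e' \<in> E i" using same_block_if_initial_edges[OF assms i(2,1)] .
  then show ?thesis using split_rng_block[OF _ i(1)] i(2) by metis
next
  case False
  with assms initial_edge_rng have "rng \<Lambda> (par e) = rng \<Lambda> l" "rng \<Lambda> (par e') = rng \<Lambda> l"
    by auto
  with False show ?thesis using split_rng_other by metis
qed

text \<open>
  The range of the lift of \<open>l\<close> with source \<open>x\<close>. The copy of the initial edge plays no role, so
  \<open>Orig\<close> may be used even if the source of that edge is \<open>v\<close>.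
\<close>

definition lift_rng :: "'m \<Rightarrow> 'm split \<Rightarrow> 'm split" where
  "lift_rng l x = (if deg \<Lambda> l = 0 then x else erng GI (Orig (SOME a. initial_edge a l)))"

lemma lift_rng_vertex [simp]: "deg \<Lambda> l = 0 \<Longrightarrow> lift_rng l x = x"
  by (simp add: lift_rng_def)

lemma initial_edge_deg: "initial_edge a l \<Longrightarrow> deg \<Lambda> l \<noteq> 0"
  using edge_deg_nonzero[of a] by (auto simp: initial_edge_def deg_cmp edge_Mor vec_eq_iff)

text \<open>The choice made in the definition of \<open>lift_rng\<close> is immaterial.\<close>

lemma lift_rng_initial:
  assumes "initial_edge (par e) l"
  shows "lift_rng l x = erng GI e"
proof -
  have "initial_edge (SOME a. initial_edge a l) l"
    using assms by (rule someI)
  then have "erng GI (Orig (SOME a. initial_edge a l)) = erng GI e"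
    using assms by (intro split_rng_initial[of _ l]) simp_all
  then show ?thesis using assms initial_edge_deg by (simp only: lift_rng_def if_False)
qed

text \<open>
  A morphism \<open>l\<close> with a lift \<open>x\<close> of its source represents all paths of the split graph that start
  at \<open>x\<close> and lie above \<open>l\<close>. Objects are the pairs \<open>(w, x)\<close> with \<open>w\<close> a vertex and \<open>x\<close> a lift of \<open>w\<close>.
\<close>

definition split_model :: "('m \<times> 'm split, 'k) kcat" where
  "split_model = \<lparr>Mor = {(l, x). l \<in> Mor \<Lambda> \<and> x \<in> Verts GI \<and> par x = src \<Lambda> l},
     rng = (\<lambda>(l, x). (rng \<Lambda> l, lift_rng l x)),
     src = (\<lambda>(l, x). (src \<Lambda> l, x)),
     cmp = (\<lambda>(l, x) (m, y). (cmp \<Lambda> l m, y)),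
     deg = (\<lambda>(l, x). deg \<Lambda> l)\<rparr>"

lemma split_model_simps [simp]:
  "(l, x) \<in> Mor split_model \<longleftrightarrow> l \<in> Mor \<Lambda> \<and> x \<in> Verts GI \<and> par x = src \<Lambda> l"
  "rng split_model (l, x) = (rng \<Lambda> l, lift_rng l x)"
  "src split_model (l, x) = (src \<Lambda> l, x)"
  "cmp split_model (l, x) (m, y) = (cmp \<Lambda> l m, y)"
  "deg split_model (l, x) = deg \<Lambda> l"
  by (simp_all add: split_model_def)

lemma lift_rng_Verts:
  assumes "(l, x) \<in> Mor split_model"
  shows "lift_rng l x \<in> Verts GI" "par (lift_rng l x) = rng \<Lambda> l"
proof -
  have "lift_rng l x \<in> Verts GI \<and> par (lift_rng l x) = rng \<Lambda> l"
  proof (cases "deg \<Lambda> l = 0")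
    case True
    then show ?thesis using assms deg_0_identity by auto
  next
    case False
    then obtain a where a: "initial_edge a l" using initial_edge_exists assms by auto
    then have "lift_rng l x = erng GI (Orig a)" by (intro lift_rng_initial) simp
    moreover have "a \<in> edges \<Lambda>" using a by (simp add: initial_edge_def)
    ultimately show ?thesis
      using split_rng_Verts[of "Orig a"] initial_edge_rng[OF a] by simp
  qed
  then show "lift_rng l x \<in> Verts GI" "par (lift_rng l x) = rng \<Lambda> l" by auto
qed

lemma lift_rng_cmp:
  assumes "(l, x) \<in> Mor split_model" "(m, y) \<in> Mor split_model"
    "src \<Lambda> l = rng \<Lambda> m" "x = lift_rng m y"
  shows "lift_rng (cmp \<Lambda> l m) y = lift_rng l x"
proof (cases "deg \<Lambda> l = 0")
  case True
  then have "l = rng \<Lambda> m" using assms deg_0_identity[of l] by simp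
  then have "cmp \<Lambda> l m = m" using assms cmp_rng by simp
  then show ?thesis using True assms by simp
next
  case False
  then obtain a where a: "initial_edge a l" using initial_edge_exists assms by auto
  then have "initial_edge a (cmp \<Lambda> l m)" using assms by (intro initial_edge_cmp) auto
  then have "lift_rng (cmp \<Lambda> l m) y = erng GI (Orig a)" by (intro lift_rng_initial) simp
  moreover have "lift_rng l x = erng GI (Orig a)" using a by (intro lift_rng_initial) simp
  ultimately show ?thesis by simp
qed

lemma kgraph_split_model: "kgraph split_model"
proof
  have "finite (Verts GI - range Orig)"
    by (rule finite_subset[of _ "{Copy 1 v, Copy 2 v}"]) (auto simp: split_vertices_def)
  moreover have "countable (vertices \<Lambda>)"
    using countable_Mor by (rule countable_subset[rotated]) (auto simp: vertexD)
  ultimately have "countable (Verts GI)"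
    by (auto simp: split_vertices_def)
  then have "countable (Mor \<Lambda> \<times> Verts GI)" using countable_Mor by blast
  then show "countable (Mor split_model)"
    by (rule countable_subset[rotated]) auto
next
  fix l' and n m :: "nat ^ 'k"
  assume "l' \<in> Mor split_model" "deg split_model l' = n + m"
  then obtain l x where l: "l' = (l, x)" "l \<in> Mor \<Lambda>" "x \<in> Verts GI" "par x = src \<Lambda> l"
    "deg \<Lambda> l = m + n"
    by (cases l') (auto simp: add.commute)
  obtain \<mu> \<nu> where f: "\<mu> \<in> Mor \<Lambda>" "\<nu> \<in> Mor \<Lambda>" "deg \<Lambda> \<mu> = m" "deg \<Lambda> \<nu> = n"
    "src \<Lambda> \<mu> = rng \<Lambda> \<nu>" "l = cmp \<Lambda> \<mu> \<nu>"
    using factorization_exists[OF l(2,5)] .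
  have nu: "(\<nu>, x) \<in> Mor split_model" using f l by (simp add: src_cmp)
  show "\<exists>!(\<mu>, \<nu>). \<mu> \<in> Mor split_model \<and> \<nu> \<in> Mor split_model \<and> deg split_model \<mu> = m
      \<and> deg split_model \<nu> = n \<and> src split_model \<mu> = rng split_model \<nu>
      \<and> l' = cmp split_model \<mu> \<nu>"
  proof (rule ex1I[of _ "((\<mu>, lift_rng \<nu> x), (\<nu>, x))"], goal_cases)
    case 1
    then show ?case using l f nu lift_rng_Verts[OF nu] by simp
  next
    case (2 z)
    then obtain \<alpha> y \<beta> w where z: "z = ((\<alpha>, y), (\<beta>, w))" by (metis surj_pair)
    have "\<mu> = \<alpha> \<and> \<nu> = \<beta>"
      using 2 l f unfolding z by (intro factorization_unique) auto
    then show ?case using 2 l unfolding z by simp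
  qed
next
  fix f assume "f \<in> Mor split_model"
  then show "rng split_model f \<in> Mor split_model"
    using lift_rng_Verts by (cases f) (simp add: rng_Mor src_rng del: GI_simps)
qed (auto simp: lift_rng_cmp src_Mor cmp_Mor rng_cmp src_cmp deg_cmp
    rng_rng src_rng rng_src src_src cmp_rng cmp_src cmp_assoc deg_id)

lemma block_contains_all_colours:
  assumes "source_free \<Lambda>" "j \<in> {1, 2}"
  shows "\<exists>f\<in>E j. deg \<Lambda> f = axis i 1"
proof -
  obtain a where a: "a \<in> E j"
    using partition assms(2) by (auto simp: is_edge_partition_def)
  then have ae: "a \<in> edges \<Lambda>" using block_edge assms(2) by auto
  then obtain c where c: "deg \<Lambda> a = axis c 1"
    using total_eq_1_axis by (auto simp: edges_def)
  have "\<not> is_source \<Lambda> (src \<Lambda> a)" using assms(1) by (simp add: source_free_def)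
  then obtain b where b: "b \<in> Mor \<Lambda>" "deg \<Lambda> b = axis i 1" "rng \<Lambda> b = src \<Lambda> a"
    using src_vertex[OF edge_Mor[OF ae]] by (auto simp: is_source_def mor_of_deg_def)
  let ?l = "cmp \<Lambda> a b"
  have l: "?l \<in> Mor \<Lambda>" "deg \<Lambda> ?l = axis i 1 + axis c 1"
    using edge_Mor[OF ae] b c by (simp_all add: cmp_Mor deg_cmp add.commute)
  obtain f g where f: "f \<in> Mor \<Lambda>" "g \<in> Mor \<Lambda>" "deg \<Lambda> f = axis i 1"
    "src \<Lambda> f = rng \<Lambda> g" "?l = cmp \<Lambda> f g"
    using factorization_exists[OF l] by metis
  then have "initial_edge f ?l" by (auto simp: initial_edge_def edges_def)
  moreover have "initial_edge a ?l" using ae b by (auto simp: initial_edge_def intro!: bexI[of _ b])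
  ultimately have "f \<in> E j" using a assms(2) same_block_if_initial_edges by blast
  then show ?thesis using f by auto
qed

lemma source_free_split_model:
  assumes "source_free \<Lambda>"
  shows "source_free split_model"
  unfolding source_free_def is_source_def
proof (intro allI notI, elim conjE exE)
  fix u i
  assume "u \<in> vertices split_model"
    and none: "{f \<in> mor_of_deg split_model (axis i 1). rng split_model f = u} = {}"
  then obtain w x where u: "u = (w, x)" "w \<in> vertices \<Lambda>" "x \<in> Verts GI" "par x = w"
    by (cases u) (auto simp: vertices_def mor_of_deg_def dest: deg_0_identity)
  have "\<exists>a. a \<in> edges \<Lambda> \<and> deg \<Lambda> a = axis i 1 \<and> rng \<Lambda> a = w \<and> erng GI (Orig a) = x"
  proof (cases "w = v")
    case True
    then obtain j where j: "j \<in> {1, 2}" "x = Copy j v"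
      using u by (auto simp: split_vertices_def)
    obtain f where f: "f \<in> E j" "deg \<Lambda> f = axis i 1"
      using block_contains_all_colours[OF assms j(1)] by blast
    then have "erng GI (Orig f) = x"
      using j split_rng_block[of "Orig f" j] by simp
    then show ?thesis using f j block_edge[OF j(1) f(1)] True by blast
  next
    case False
    then have x: "x = Orig w" using u by (auto simp: split_vertices_def)
    have "\<not> is_source \<Lambda> w" using assms by (simp add: source_free_def)
    then obtain a where a: "a \<in> edges \<Lambda>" "deg \<Lambda> a = axis i 1" "rng \<Lambda> a = w"
      using u by (auto simp: is_source_def mor_of_deg_def edges_def)
    then have "erng GI (Orig a) = x" using False x split_rng_other[of "Orig a"] by simp
    then show ?thesis using a by blast
  qed
  then obtain a where a: "a \<in> edges \<Lambda>" "deg \<Lambda> a = axis i 1" "rng \<Lambda> a = w"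
    "erng GI (Orig a) = x" by blast
  obtain y where y: "y \<in> Verts GI" "par y = src \<Lambda> a"
    using lift_vertex_exists src_vertex edge_Mor a(1) by blast
  have "lift_rng a y = x"
    using lift_rng_initial[of "Orig a" a y] initial_edge_refl[OF a(1)] a(4) by simp
  then have "(a, y) \<in> {f \<in> mor_of_deg split_model (axis i 1). rng split_model f = u}"
    using a y u edge_Mor by (auto simp: mor_of_deg_def)
  with none show False by blast
qed

section \<open>Paths in the split graph\<close>

text \<open>The lifted morphism represented by a path of the split graph.\<close>

definition path_eval :: "('m split, 'm split) walk \<Rightarrow> 'm \<times> 'm split" where
  "path_eval p = (compose_path \<Lambda> (par_path p), path_src GI p)"

lemma par_path_simps [simp]:
  "par_path (Point x) = Point (par x)" "par_path (Trail es) = Trail (map par es)"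
  by (simp_all add: par_path_def)

lemma par_path_concat: "par_path (concat_path p q) = concat_path (par_path p) (par_path q)"
  by (cases p; cases q) auto

lemma path_ends:
  assumes "p \<in> paths GI"
  shows "path_rng GI p \<in> Verts GI" "path_src GI p \<in> Verts GI"
  using assms split_rng_Verts(1)[OF par_Edges] split_src_Verts
  by (intro path_ends_in_Verts; blast)+

lemma par_path_in_paths:
  assumes "p \<in> paths GI"
  shows "par_path p \<in> paths (skeleton \<Lambda>)"
    "path_rng (skeleton \<Lambda>) (par_path p) = par (path_rng GI p)"
    "path_src (skeleton \<Lambda>) (par_path p) = par (path_src GI p)"
    "path_deg (skeleton \<Lambda>) (par_path p) = path_deg GI p"
proof -
  have "par_path p \<in> paths (skeleton \<Lambda>) \<and>
    path_rng (skeleton \<Lambda>) (par_path p) = par (path_rng GI p) \<and>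
    path_src (skeleton \<Lambda>) (par_path p) = par (path_src GI p) \<and>
    path_deg (skeleton \<Lambda>) (par_path p) = path_deg GI p"
    using assms
  proof (induction rule: path_induct)
    case (Point x)
    then show ?case using par_Verts by (simp add: paths_def)
  next
    case (Edge e)
    then show ?case
      using par_Edges[OF Edge] split_rng_Verts(2)[OF par_Edges[OF Edge]] par_split_src[of e]
      by (simp add: paths_def)
  next
    case (Cons e f es)
    then have "src \<Lambda> (par e) = rng \<Lambda> (par f)"
      using par_split_src[of e] by simp
    then show ?case
      using Cons par_Edges[OF Cons(1)] split_rng_Verts(2)[OF par_Edges[OF Cons(1)]]
      by (simp add: paths_def)
  qed
  then show "par_path p \<in> paths (skeleton \<Lambda>)"
    "path_rng (skeleton \<Lambda>) (par_path p) = par (path_rng GI p)"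
    "path_src (skeleton \<Lambda>) (par_path p) = par (path_src GI p)"
    "path_deg (skeleton \<Lambda>) (par_path p) = path_deg GI p" by auto
qed

lemma path_eval_Point: "path_eval (Point x) = (par x, x)"
  by (simp add: path_eval_def)

lemma path_eval_Edge: "path_eval (Trail [e]) = (par e, esrc GI e)"
  by (simp add: path_eval_def)

lemma path_eval_concat:
  assumes "p \<in> paths GI" "q \<in> paths GI" "path_src GI p = path_rng GI q"
  shows "path_eval (concat_path p q) = cmp split_model (path_eval p) (path_eval q)"
  using assms
  by (simp add: path_eval_def par_path_concat compose_path_concat par_path_in_paths
      concat_path_in_paths)

lemma path_eval_Mor:
  assumes "p \<in> paths GI"
  shows "path_eval p \<in> Mor split_model"
    "src split_model (path_eval p) = path_eval (Point (path_src GI p))"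
    "deg split_model (path_eval p) = path_deg GI p"
proof -
  note q = par_path_in_paths[OF assms]
  note c = compose_path_Mor[OF q(1)]
  show "path_eval p \<in> Mor split_model"
    "src split_model (path_eval p) = path_eval (Point (path_src GI p))"
    "deg split_model (path_eval p) = path_deg GI p"
    using c q path_ends(2)[OF assms] by (simp_all add: path_eval_def del: GI_simps)
qed

text \<open>
  The range of a path in the split graph depends only on the lifted morphism, because the
  leftmost edge of a trail maps to an initial edge of the composite.
\<close>

lemma path_eval_rng:
  assumes "p \<in> paths GI"
  shows "rng split_model (path_eval p) = path_eval (Point (path_rng GI p))"
  using assms
proof (induction rule: path_induct)
  case (Point x)
  then show ?case
    using vertexD[OF par_Verts[OF Point]] by (simp add: path_eval_Point)
next
  case (Edge e)
  note e = par_Edges[OF Edge]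
  have "lift_rng (par e) (esrc GI e) = erng GI e"
    using initial_edge_refl[OF e] by (rule lift_rng_initial)
  then show ?case
    using split_rng_Verts(2)[OF e] by (simp add: path_eval_Edge path_eval_Point)
next
  case (Cons e f es)
  interpret M: kgraph split_model by (rule kgraph_split_model)
  let ?q = "Trail (f # es)"
  note e = par_Edges[OF Cons(1)]
  have p: "Trail [e] \<in> paths GI" using Cons(1) by (simp add: paths_def)
  have s: "path_src GI (Trail [e]) = path_rng GI ?q" using Cons(3) by simp
  have c: "src split_model (path_eval (Trail [e])) = rng split_model (path_eval ?q)"
    using path_eval_Mor(2)[OF p] s Cons(4) by metis
  have "path_eval (Trail (e # f # es)) = cmp split_model (path_eval (Trail [e])) (path_eval ?q)"
    using path_eval_concat[OF p Cons(2) s] by simp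
  then have "rng split_model (path_eval (Trail (e # f # es)))
      = rng split_model (path_eval (Trail [e]))"
    using M.rng_cmp[OF path_eval_Mor(1)[OF p] path_eval_Mor(1)[OF Cons(2)] c] by simp
  also have "\<dots> = (rng \<Lambda> (par e), lift_rng (par e) (esrc GI e))"
    by (simp add: path_eval_Edge)
  also have "lift_rng (par e) (esrc GI e) = erng GI e"
    using initial_edge_refl[OF e] by (rule lift_rng_initial)
  finally show ?case
    using split_rng_Verts(2)[OF e] by (simp add: path_eval_Point)
qed

lemma path_eval_surj:
  assumes "(l, x) \<in> Mor split_model"
  shows "\<exists>p\<in>paths GI. path_eval p = (l, x)"
  using assms
proof (induction "total (deg \<Lambda> l)" arbitrary: l rule: less_induct)
  case less
  show ?case
  proof (cases "deg \<Lambda> l = 0")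
    case True
    then have "path_eval (Point x) = (l, x)"
      using less(2) deg_0_identity[of l] by (simp add: path_eval_Point)
    then show ?thesis using less(2) by (intro bexI[of _ "Point x"]) (auto simp: paths_def)
  next
    case False
    then obtain a \<mu> where a: "a \<in> edges \<Lambda>" "\<mu> \<in> Mor \<Lambda>" "src \<Lambda> a = rng \<Lambda> \<mu>" "l = cmp \<Lambda> a \<mu>"
      using initial_edge_exists[of l] less(2) by (auto simp: initial_edge_def)
    have mu: "(\<mu>, x) \<in> Mor split_model"
      using a less(2) edge_Mor[OF a(1)] by (simp add: src_cmp)
    have "total (deg \<Lambda> \<mu>) < total (deg \<Lambda> l)"
      using a edge_Mor[OF a(1)] by (simp add: deg_cmp total_plus edges_def)
    then obtain q where q: "q \<in> paths GI" "path_eval q = (\<mu>, x)"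
      using less(1) mu by blast
    have "path_rng GI q = lift_rng \<mu> x"
      using path_eval_rng[OF q(1)] q(2) by (simp add: path_eval_Point)
    then have y: "path_rng GI q \<in> Verts GI" "par (path_rng GI q) = src \<Lambda> a"
      using lift_rng_Verts[OF mu] a by simp_all
    obtain e where e: "e \<in> Edges GI" "par e = a" "esrc GI e = path_rng GI q"
      using lift_edge[OF a(1) y] .
    have p: "Trail [e] \<in> paths GI" "path_src GI (Trail [e]) = path_rng GI q"
      using e by (simp_all add: paths_def)
    have "path_eval (concat_path (Trail [e]) q) = (l, x)"
      using path_eval_concat[OF p(1) q(1) p(2)] q(2) e(2) a(4) by (simp add: path_eval_Edge)
    then show ?thesis using concat_path_in_paths(1)[OF p(1) q(1) p(2)] by blast
  qed
qed

section \<open>The isomorphism onto the in-splitting\<close>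

abbreviation lambda_I :: "(('m split, 'm split) walk set, 'k) kcat" where
  "lambda_I \<equiv> in_splitting \<Lambda> v E"

text \<open>The class of all paths that represent a given lifted morphism.\<close>

definition path_class :: "'m \<times> 'm split \<Rightarrow> ('m split, 'm split) walk set" where
  "path_class z = {p \<in> paths GI. path_eval p = z}"

text \<open>The condition on ranges in the equivalence of paths is implied by the other two.\<close>

lemma split_equiv_iff:
  "(p, q) \<in> split_equiv \<Lambda> v E \<longleftrightarrow> p \<in> paths GI \<and> q \<in> paths GI \<and> path_eval p = path_eval q"
proof -
  have "path_rng GI p = path_rng GI q"
    if "p \<in> paths GI" "q \<in> paths GI" "path_eval p = path_eval q"
    using path_eval_rng[OF that(1)] path_eval_rng[OF that(2)] that(3)
    by (simp add: path_eval_Point)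
  then show ?thesis
    using par_path_in_paths(1)
    by (auto simp: split_equiv_def Let_def path_equiv_def path_eval_def)
qed

lemma split_equiv_Image:
  "p \<in> paths GI \<Longrightarrow> split_equiv \<Lambda> v E `` {p} = path_class (path_eval p)"
  by (auto simp: split_equiv_iff path_class_def)

lemma path_class_nonempty: "z \<in> Mor split_model \<Longrightarrow> path_class z \<noteq> {}"
  using path_eval_surj by (cases z) (auto simp: path_class_def)

lemma Point_in_paths: "x \<in> Verts GI \<Longrightarrow> Point x \<in> paths GI"
  by (simp add: paths_def)

lemma kcat_iso_path_class: "kcat_iso split_model lambda_I path_class"
proof
  have "inj_on path_class (Mor split_model)"
  proof (rule inj_onI)
    fix f g assume "f \<in> Mor split_model" and eq: "path_class f = path_class g"
    then obtain p where p: "p \<in> path_class f" using path_class_nonempty by blast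
    moreover have "p \<in> path_class g" using p eq by simp
    ultimately show "f = g" by (simp add: path_class_def)
  qed
  moreover have "Mor lambda_I = path_class ` path_eval ` paths GI"
    using split_equiv_Image by (auto simp: in_splitting_def Let_def quotient_def image_iff)
  moreover have "path_eval ` paths GI = Mor split_model"
    using path_eval_surj path_eval_Mor(1) by (auto simp: image_iff) metis+
  ultimately show "bij_betw path_class (Mor split_model) (Mor lambda_I)"
    by (simp add: bij_betw_def)
next
  fix f assume f: "f \<in> Mor split_model"
  have 1: "split_equiv \<Lambda> v E `` {Point (path_rng GI p)} = path_class (rng split_model f)"
    "split_equiv \<Lambda> v E `` {Point (path_src GI p)} = path_class (src split_model f)"
    "path_deg GI p = deg split_model f"
    if "p \<in> path_class f" for p
    using that path_eval_rng path_eval_Mor path_ends split_equiv_Image Point_in_paths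
    by (auto simp: path_class_def)
  show "rng lambda_I (path_class f) = path_class (rng split_model f)"
    using path_class_nonempty[OF f] 1 by (simp add: in_splitting_def Let_def)
  show "src lambda_I (path_class f) = path_class (src split_model f)"
    using path_class_nonempty[OF f] 1 by (simp add: in_splitting_def Let_def)
  have "path_deg GI ` path_class f = {deg split_model f}"
    using 1(3) path_class_nonempty[OF f] by auto
  then show "deg lambda_I (path_class f) = deg split_model f"
    by (simp add: in_splitting_def Let_def)
next
  fix f g assume f: "f \<in> Mor split_model" and g: "g \<in> Mor split_model"
    and fg: "src split_model f = rng split_model g"
  have "split_equiv \<Lambda> v E `` {concat_path p q} = path_class (cmp split_model f g)"
    if p: "p \<in> path_class f" and q: "q \<in> path_class g" for p q
  proof -
    have pq: "p \<in> paths GI" "q \<in> paths GI" "path_eval p = f" "path_eval q = g"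
      using p q by (auto simp: path_class_def)
    then have "path_src GI p = path_rng GI q"
      using fg path_eval_Mor(2)[of p] path_eval_rng[of q] by (simp add: path_eval_Point)
    then show ?thesis
      using pq path_eval_concat concat_path_in_paths split_equiv_Image by metis
  qed
  then show "cmp lambda_I (path_class f) (path_class g) = path_class (cmp split_model f g)"
    using path_class_nonempty[OF f] path_class_nonempty[OF g]
    by (simp add: in_splitting_def Let_def)
qed

end

theorem theorem3p12:
  fixes \<Lambda> :: "('m, 'k::finite) kcat" and v :: 'm and E :: "nat \<Rightarrow> 'm set"
  assumes "kgraph \<Lambda>"
    and "source_free \<Lambda>"
    and "v \<in> vertices \<Lambda>"
    and "is_edge_partition \<Lambda> v E"
    and "pairing_condition \<Lambda> v E"
  shows "kgraph (in_splitting \<Lambda> v E) \<and> source_free (in_splitting \<Lambda> v E)"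
proof -
  interpret splitting \<Lambda> v E
    using assms by (intro splitting.intro splitting_axioms.intro)
  interpret kcat_iso split_model "in_splitting \<Lambda> v E" path_class
    by (rule kcat_iso_path_class)
  show ?thesis
    using kgraph_iso source_free_iso kgraph_split_model source_free_split_model assms(2)
    by (auto simp: kgraph_def)
qed

end
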